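(* (i) If $G$ is a topological group, then for every integer $n\geqslant 1$, every $a\in G$ and all $d_{1},\ldots,d_{n}\in\mathbb{Z}$, the monomial function $G^{n}\rightarrow G$ given by $(x_{1},\ldots,x_{n})\mapsto a x_{1}^{d_{1}}\cdots x_{n}^{d_{n}}$ is continuous. (ii) If $R$ is a commutative topological ring, then for every integer $n\geqslant 1$ and every polynomial $f(x_{1},\ldots,x_{n})\in R[x_{1},\ldots,x_{n}]$, the polynomial function $R^{n}\rightarrow R$ given by $(r_{1},\ldots,r_{n})\mapsto f(r_{1},\ldots,r_{n})$ is continuous.
   Context: $G^{n}$ and $R^{n}$ carry the product topology. Rings are commutative with identity; a topological ring is a ring with a topology for which the ring operations are continuous. The group $G$ need not be abelian, and no separation axiom is assumed. *)

theory Defs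
  imports
    "HOL-Analysis.Function_Topology"
    "HOL-Analysis.Product_Topology"
    "HOL-Algebra.Indexed_Polynomials"
begin

locale topological_group = group G for G (structure) +
  fixes T :: "'a topology"
  assumes topspace_eq_carrier: "topspace T = carrier G"
    and continuous_mult: "continuous_map (prod_topology T T) T (\<lambda>(x, y). x \<otimes> y)"
    and continuous_inv: "continuous_map T T (\<lambda>x. inv x)"

locale comm_topological_ring = cring R for R (structure) +
  fixes T :: "'a topology"
  assumes topspace_eq_carrier: "topspace T = carrier R"
    and continuous_add: "continuous_map (prod_topology T T) T (\<lambda>(x, y). x \<oplus> y)"
    and continuous_neg: "continuous_map T T (\<lambda>x. \<ominus> x)"
    and continuous_mult: "continuous_map (prod_topology T T) T (\<lambda>(x, y). x \<otimes> y)"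

text \<open>
  Points of the n-th power of a carrier set are the extensional functions on \<open>{1..n}\<close>, the
  points of \<^const>\<open>product_topology\<close> over the index set \<open>{1..n}\<close>.
\<close>

abbreviation power_topology :: "nat \<Rightarrow> 'a topology \<Rightarrow> (nat \<Rightarrow> 'a) topology"
  where "power_topology n T \<equiv> product_topology (\<lambda>_. T) {1..n}"

text \<open>
  The factors are multiplied from left to right, in the order of their indices, as the group
  need not be abelian.
\<close>

definition monomial_fun ::
    "('a, 'b) monoid_scheme \<Rightarrow> nat \<Rightarrow> 'a \<Rightarrow> (nat \<Rightarrow> int) \<Rightarrow> (nat \<Rightarrow> 'a) \<Rightarrow> 'a"
  where "monomial_fun G n a d x =
    foldl (\<lambda>g i. g \<otimes>\<^bsub>G\<^esub> (x i [^]\<^bsub>G\<^esub> d i)) a [1..<Suc n]"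

text \<open>
  \<^const>\<open>ring.indexed_pset\<close> represents a polynomial by its coefficient function; the
  multiset \<open>m\<close> stands for the monomial in which the \<open>i\<close>-th variable has exponent
  \<open>count m i\<close>.
\<close>

abbreviation polynomials :: "('a, 'b) ring_scheme \<Rightarrow> nat \<Rightarrow> (nat multiset \<Rightarrow> 'a) set"
  where "polynomials R n \<equiv> ring.indexed_pset R {1..n} (carrier R)"

definition polynomial_fun ::
    "('a, 'b) ring_scheme \<Rightarrow> nat \<Rightarrow> (nat multiset \<Rightarrow> 'a) \<Rightarrow> (nat \<Rightarrow> 'a) \<Rightarrow> 'a"
  where "polynomial_fun R n f r =
    (\<Oplus>\<^bsub>R\<^esub>m \<in> {m. f m \<noteq> \<zero>\<^bsub>R\<^esub>}. f m \<otimes>\<^bsub>R\<^esub> (\<Otimes>\<^bsub>R\<^esub>i \<in> {1..n}. r i [^]\<^bsub>R\<^esub> count m i))"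

text \<open>The sum above is finite, so \<^const>\<open>finsum\<close> does not take its default value.\<close>

lemma (in ring) indexed_pset_finite_support:
  assumes "P \<in> indexed_pset I (carrier R)"
  shows "finite {m. P m \<noteq> \<zero>}"
  using assms
proof induction
  case (indexed_const k)
  have "{m. indexed_const k m \<noteq> \<zero>} \<subseteq> {{#}}"
    by (auto simp: indexed_const_def)
  then show ?case
    using finite_subset by blast
next
  case (indexed_padd P Q)
  have "{m. indexed_padd P Q m \<noteq> \<zero>} \<subseteq> {m. P m \<noteq> \<zero>} \<union> {m. Q m \<noteq> \<zero>}"
    by (auto simp: indexed_padd_def)
  then show ?case
    using indexed_padd.IH finite_subset by blast
next
  case (indexed_pmult P i)
  have "m \<in> add_mset i ` {m. P m \<noteq> \<zero>}" if "indexed_pmult P i m \<noteq> \<zero>" for m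
    using that by (intro image_eqI[of _ _ "m - {#i#}"]) (auto simp: indexed_pmult_def split: if_splits)
  then have "{m. indexed_pmult P i m \<noteq> \<zero>} \<subseteq> add_mset i ` {m. P m \<noteq> \<zero>}"
    by blast
  then show ?case
    using indexed_pmult.IH finite_subset by blast
qed

end

theory Submission
  imports Defs
begin

text \<open>
  For a monoid \<open>M\<close> whose multiplication is continuous, the continuous maps from any fixed
  space \<open>Y\<close> into \<open>M\<close> are closed under pointwise multiplication, since \<open>x \<mapsto> f x \<otimes> g x\<close> is the
  multiplication composed with the continuous map \<open>x \<mapsto> (f x, g x)\<close>. They are therefore closed
  under pointwise powers and, when \<open>M\<close> is commutative, under pointwise finite products. Taking for \<open>Y\<close> the
  \<open>n\<close>-th power of the topological group or ring, monomial and polynomial functions are built by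
  these operations from constants and coordinate projections, both of which are continuous. Negative
  exponents are where the continuity of inversion enters. For rings the closure
  properties are used twice: the multiplicative monoid gives the continuity of every monomial, and
  the additive monoid that of the finite sum of the terms.
\<close>

lemma continuous_map_power_projection:
  assumes "i \<in> {1..n}"
  shows "continuous_map (power_topology n T) T (\<lambda>x. x i)"
  using continuous_map_product_projection[OF assms, of "\<lambda>_. T"] by simp

text \<open>
  Isolating the monoid structure allows the multiplicative and the additive monoid of a ring
  to be treated by the same lemmas.
\<close>

locale topological_monoid = monoid M for M (structure) +
  fixes T :: "'a topology"
  assumes topspace_eq_carrier: "topspace T = carrier M"
    and continuous_mult: "continuous_map (prod_topology T T) T (\<lambda>(x, y). x \<otimes> y)"
begin

lemma continuous_map_closed:
  assumes "continuous_map Y T f" and "x \<in> topspace Y"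
  shows "f x \<in> carrier M"
  using continuous_map_image_subset_topspace[OF assms(1)] assms(2) topspace_eq_carrier by blast

lemma continuous_map_mult:
  assumes "continuous_map Y T f" and "continuous_map Y T g"
  shows "continuous_map Y T (\<lambda>x. f x \<otimes> g x)"
proof -
  have "continuous_map Y (prod_topology T T) (\<lambda>x. (f x, g x))"
    using assms by (simp add: continuous_map_paired)
  from continuous_map_compose[OF this continuous_mult] show ?thesis
    by (simp add: o_def)
qed

lemma continuous_map_nat_pow:
  assumes "continuous_map Y T f"
  shows "continuous_map Y T (\<lambda>x. f x [^] (k :: nat))"
proof (induction k)
  case 0
  show ?case
    by (simp add: topspace_eq_carrier)
next
  case (Suc k)
  show ?case
    using continuous_map_mult[OF Suc assms] by simp
qed

end

lemma continuous_map_finprod: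
  assumes "topological_monoid M T" and "comm_monoid M" and "finite A"
    and "\<And>i. i \<in> A \<Longrightarrow> continuous_map Y T (f i)"
  shows "continuous_map Y T (\<lambda>x. \<Otimes>\<^bsub>M\<^esub>i\<in>A. f i x)"
proof -
  interpret topological_monoid M T by fact
  interpret comm_monoid M by fact
  show ?thesis
    using assms(3,4)
  proof (induction A rule: finite_induct)
    case empty
    show ?case
      by (simp add: topspace_eq_carrier)
  next
    case (insert j A)
    have "continuous_map Y T (\<lambda>x. f j x \<otimes>\<^bsub>M\<^esub> (\<Otimes>\<^bsub>M\<^esub>i\<in>A. f i x))"
      by (rule continuous_map_mult) (simp_all add: insert)
    \<comment> \<open>The recursion for finite products needs factors in the carrier, so the two functions
        are only known to agree at points of \<open>Y\<close>.\<close>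
    then show ?case
    proof (rule continuous_map_eq)
      fix x assume "x \<in> topspace Y"
      then have "f i x \<in> carrier M" if "i \<in> insert j A" for i
        using continuous_map_closed[OF insert.prems[OF that]] by simp
      then show "f j x \<otimes>\<^bsub>M\<^esub> (\<Otimes>\<^bsub>M\<^esub>i\<in>A. f i x) = (\<Otimes>\<^bsub>M\<^esub>i\<in>insert j A. f i x)"
        using insert.hyps by (subst finprod_insert) auto
    qed
  qed
qed

sublocale topological_group \<subseteq> topological_monoid G T
  by unfold_locales (fact topspace_eq_carrier continuous_mult)+

lemma (in topological_group) continuous_map_int_pow:
  assumes "continuous_map Y T f"
  shows "continuous_map Y T (\<lambda>x. f x [^] (k :: int))"
proof (cases "k \<ge> 0")
  case True
  then show ?thesis
    using continuous_map_nat_pow[OF assms, of "nat k"]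
    by (simp only: int_pow_def2 not_less[symmetric] if_False)
next
  case False
  then show ?thesis
    using continuous_map_compose[OF continuous_map_nat_pow[OF assms, of "nat (- k)"] continuous_inv]
    by (simp only: int_pow_def2 not_le if_True o_def)
qed

lemma (in topological_group) continuous_map_monomial_fun:
  assumes "a \<in> carrier G"
  shows "continuous_map (power_topology n T) T (monomial_fun G n a d)"
proof -
  have "continuous_map (power_topology n T) T (\<lambda>x. foldl (\<lambda>g i. g \<otimes> (x i [^] d i)) a is)"
    if "set is \<subseteq> {1..n}" for "is"
    using that
    \<comment> \<open>The products associate to the left, so the factor split off in the induction step is
        the last one.\<close>
  proof (induction "is" rule: rev_induct)
    case Nil
    show ?case
      using assms by (simp add: topspace_eq_carrier)
  next
    case (snoc i "is")
    then have "continuous_map (power_topology n T) T (\<lambda>x. x i [^] d i)"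
      by (intro continuous_map_int_pow continuous_map_power_projection) auto
    then show ?case
      using continuous_map_mult snoc by simp
  qed
  from this[of "[1..<Suc n]"] show ?thesis
    by (simp add: monomial_fun_def[abs_def] atLeastLessThanSuc_atLeastAtMost del: upt_Suc)
qed

context comm_topological_ring
begin

lemma topological_monoid_mult: "topological_monoid R T"
  by unfold_locales (fact topspace_eq_carrier continuous_mult)+

lemma topological_monoid_add: "topological_monoid (add_monoid R) T"
  using topspace_eq_carrier continuous_add
  by (simp add: topological_monoid_def topological_monoid_axioms_def add.monoid_axioms)

lemma continuous_map_polynomial_fun:
  assumes "f \<in> polynomials R n"
  shows "continuous_map (power_topology n T) T (polynomial_fun R n f)"
proof -
  interpret mult: topological_monoid R T
    by (rule topological_monoid_mult)
  have term_continuous: "continuous_map (power_topology n T) T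
      (\<lambda>r. f m \<otimes> (\<Otimes>i\<in>{1..n}. r i [^] count m i))" for m
  proof (rule mult.continuous_map_mult)
    have "f m \<in> carrier R"
      using indexed_pset_in_carrier[OF subset_refl assms] by (rule carrier_coeffE)
    then show "continuous_map (power_topology n T) T (\<lambda>r. f m)"
      by (simp add: topspace_eq_carrier)
    show "continuous_map (power_topology n T) T (\<lambda>r. \<Otimes>i\<in>{1..n}. r i [^] count m i)"
      by (rule continuous_map_finprod[OF topological_monoid_mult comm_monoid_axioms])
        (simp, rule mult.continuous_map_nat_pow[OF continuous_map_power_projection])
  qed
  show ?thesis
    unfolding polynomial_fun_def[abs_def] finsum_def
    by (rule continuous_map_finprod[OF topological_monoid_add add.comm_monoid_axioms
        indexed_pset_finite_support[OF assms] term_continuous])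
qed

end

theorem lemma2p9:
  fixes G :: "('a, 'b) monoid_scheme" and TG :: "'a topology"
    and R :: "('c, 'd) ring_scheme" and TR :: "'c topology"
  shows "(topological_group G TG \<longrightarrow>
            (\<forall>n\<ge>1. \<forall>a\<in>carrier G. \<forall>d :: nat \<Rightarrow> int.
               continuous_map (power_topology n TG) TG (monomial_fun G n a d)))
       \<and> (comm_topological_ring R TR \<longrightarrow>
            (\<forall>n\<ge>1. \<forall>f\<in>polynomials R n.
               continuous_map (power_topology n TR) TR (polynomial_fun R n f)))"
  by (intro conjI impI allI ballI topological_group.continuous_map_monomial_fun
      comm_topological_ring.continuous_map_polynomial_fun)

end
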